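(* Let $Q$ be a finite quandle such that $H^2(Inn(Q),\mathbb{C}^\times)$ is trivial, and let $\theta:Q\to Inn(Q)$, $x\mapsto L_x$. Let $V$ be a finite-dimensional complex Hermitian inner product space, $\rho':Inn(Q)\to GL(V)$ an irreducible linear representation and $\chi$ a character of $Q$. Then the representation $\chi\cdot(\rho'\circ\theta)$ of $Q$ takes values in the unitary group $U(V)$ if and only if $\rho'$ is unitary (i.e. takes values in $U(V)$) and $\chi$ takes values in the complex numbers of modulus $1$.
   Context: A quandle is a set $Q$ with a binary operation $\triangleright$ such that $x\triangleright x=x$; $x\triangleright(y\triangleright z)=(x\triangleright y)\triangleright(x\triangleright z)$; and for all $x,y\in Q$ there is a unique $z\in Q$ with $x\triangleright z=y$. For $x\in Q$, $L_x:Q\to Q$ is the bijection $L_x(y)=x\triangleright y$; $Inn(Q)$ is the group of bijections of $Q$ generated by all $L_x$. A representation of $Q$ on $V$ is a map $\rho:Q\to GL(V)$ with $\rho(x\triangleright y)=\rho(x)\rho(y)\rho(x)^{-1}$. A character of $Q$ is a map $\chi:Q\to\mathbb{C}^\times$ with $\chi(x\triangleright y)=\chi(y)$ for all $x,y\in Q$; $(\chi\cdot\rho)(x)=\chi(x)\rho(x)$. $H^2(G,\mathbb{C}^\times)$ denotes group cohomology with trivial action. Irreducible representations are nonzero. *)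

theory Defs
  imports Complex_Main "HOL-Algebra.Bij" "HOL-Algebra.Product_Groups"
begin

section \<open>Quandles\<close>

locale quandle =
  fixes Q :: "'q set" and qop :: "'q \<Rightarrow> 'q \<Rightarrow> 'q"  (infixl \<open>\<rhd>\<close> 65)
  assumes closed: "\<lbrakk>x \<in> Q; y \<in> Q\<rbrakk> \<Longrightarrow> x \<rhd> y \<in> Q"
    and idem: "x \<in> Q \<Longrightarrow> x \<rhd> x = x"
    and self_distrib: "\<lbrakk>x \<in> Q; y \<in> Q; z \<in> Q\<rbrakk> \<Longrightarrow> x \<rhd> (y \<rhd> z) = (x \<rhd> y) \<rhd> (x \<rhd> z)"
    and left_divisible: "\<lbrakk>x \<in> Q; y \<in> Q\<rbrakk> \<Longrightarrow> \<exists>!z. z \<in> Q \<and> x \<rhd> z = y"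

text \<open>Bijections of \<open>Q\<close> are extensional functions, as in the library group \<^term>\<open>BijGroup Q\<close>.\<close>

definition left_mult :: "'q set \<Rightarrow> ('q \<Rightarrow> 'q \<Rightarrow> 'q) \<Rightarrow> 'q \<Rightarrow> ('q \<Rightarrow> 'q)" where
  "left_mult Q qop x = (\<lambda>y\<in>Q. qop x y)"

definition Inn :: "'q set \<Rightarrow> ('q \<Rightarrow> 'q \<Rightarrow> 'q) \<Rightarrow> ('q \<Rightarrow> 'q) monoid" where
  "Inn Q qop = subgroup_generated (BijGroup Q) (left_mult Q qop ` Q)"

definition quandle_character :: "'q set \<Rightarrow> ('q \<Rightarrow> 'q \<Rightarrow> 'q) \<Rightarrow> ('q \<Rightarrow> complex) \<Rightarrow> bool" where
  "quandle_character Q qop \<chi> \<longleftrightarrow>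
     (\<forall>x\<in>Q. \<chi> x \<noteq> 0) \<and> (\<forall>x\<in>Q. \<forall>y\<in>Q. \<chi> (qop x y) = \<chi> y)"


section \<open>Second group cohomology with trivial action\<close>

text \<open>Inhomogeneous cochains, with the coefficient group written multiplicatively.\<close>

definition cochains1 :: "('g, 'x) monoid_scheme \<Rightarrow> ('a, 'y) monoid_scheme \<Rightarrow> ('g \<Rightarrow> 'a) monoid" where
  "cochains1 G A = product_group (carrier G) (\<lambda>_. A)"

definition cochains2 ::
  "('g, 'x) monoid_scheme \<Rightarrow> ('a, 'y) monoid_scheme \<Rightarrow> ('g \<times> 'g \<Rightarrow> 'a) monoid" where
  "cochains2 G A = product_group (carrier G \<times> carrier G) (\<lambda>_. A)"

definition cochains3 ::
  "('g, 'x) monoid_scheme \<Rightarrow> ('a, 'y) monoid_scheme \<Rightarrow> ('g \<times> 'g \<times> 'g \<Rightarrow> 'a) monoid" where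
  "cochains3 G A = product_group (carrier G \<times> carrier G \<times> carrier G) (\<lambda>_. A)"

definition coboundary1 ::
  "('g, 'x) monoid_scheme \<Rightarrow> ('a, 'y) monoid_scheme \<Rightarrow> ('g \<Rightarrow> 'a) \<Rightarrow> ('g \<times> 'g \<Rightarrow> 'a)" where
  "coboundary1 G A f = (\<lambda>(x, y) \<in> carrier G \<times> carrier G.
     f y \<otimes>\<^bsub>A\<^esub> inv\<^bsub>A\<^esub> f (x \<otimes>\<^bsub>G\<^esub> y) \<otimes>\<^bsub>A\<^esub> f x)"

definition coboundary2 ::
  "('g, 'x) monoid_scheme \<Rightarrow> ('a, 'y) monoid_scheme \<Rightarrow> ('g \<times> 'g \<Rightarrow> 'a) \<Rightarrow> ('g \<times> 'g \<times> 'g \<Rightarrow> 'a)" where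
  "coboundary2 G A f = (\<lambda>(x, y, z) \<in> carrier G \<times> carrier G \<times> carrier G.
     f (y, z) \<otimes>\<^bsub>A\<^esub> inv\<^bsub>A\<^esub> f (x \<otimes>\<^bsub>G\<^esub> y, z) \<otimes>\<^bsub>A\<^esub> f (x, y \<otimes>\<^bsub>G\<^esub> z) \<otimes>\<^bsub>A\<^esub> inv\<^bsub>A\<^esub> f (x, y))"

definition cocycles2 ::
  "('g, 'x) monoid_scheme \<Rightarrow> ('a, 'y) monoid_scheme \<Rightarrow> ('g \<times> 'g \<Rightarrow> 'a) monoid" where
  "cocycles2 G A =
     (cochains2 G A)\<lparr>carrier := kernel (cochains2 G A) (cochains3 G A) (coboundary2 G A)\<rparr>"

definition coboundaries2 ::
  "('g, 'x) monoid_scheme \<Rightarrow> ('a, 'y) monoid_scheme \<Rightarrow> ('g \<times> 'g \<Rightarrow> 'a) set" where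
  "coboundaries2 G A = coboundary1 G A ` carrier (cochains1 G A)"

definition H2 ::
  "('g, 'x) monoid_scheme \<Rightarrow> ('a, 'y) monoid_scheme \<Rightarrow> ('g \<times> 'g \<Rightarrow> 'a) set monoid" where
  "H2 G A = cocycles2 G A Mod coboundaries2 G A"

definition complex_units :: "complex monoid" where
  "complex_units = \<lparr>carrier = UNIV - {0}, mult = (*), one = 1\<rparr>"


section \<open>Hermitian spaces and representations\<close>

text \<open>The form is linear in the first argument and conjugate linear in the second. By conjugate
  symmetry \<open>herm v v\<close> is always real.\<close>

locale hermitian_space = vector_space scale
  for scale :: "complex \<Rightarrow> 'v::ab_group_add \<Rightarrow> 'v"  (infixr \<open>*\<^sub>s\<close> 75) +
  fixes herm :: "'v \<Rightarrow> 'v \<Rightarrow> complex"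
  assumes finite_dim: "\<exists>B. finite B \<and> span B = UNIV"
    and herm_add: "herm (u + v) w = herm u w + herm v w"
    and herm_scale: "herm (c *\<^sub>s v) w = c * herm v w"
    and herm_cnj: "herm w v = cnj (herm v w)"
    and herm_pos: "v \<noteq> 0 \<Longrightarrow> 0 < Re (herm v v)"

definition GL :: "(complex \<Rightarrow> 'v::ab_group_add \<Rightarrow> 'v) \<Rightarrow> ('v \<Rightarrow> 'v) monoid" where
  "GL scale = \<lparr>carrier = {f. Vector_Spaces.linear scale scale f \<and> bij f}, mult = (\<circ>), one = id\<rparr>"

definition unitary_group ::
  "(complex \<Rightarrow> 'v::ab_group_add \<Rightarrow> 'v) \<Rightarrow> ('v \<Rightarrow> 'v \<Rightarrow> complex) \<Rightarrow> ('v \<Rightarrow> 'v) set" where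
  "unitary_group scale herm = {f \<in> carrier (GL scale). \<forall>v w. herm (f v) (f w) = herm v w}"

definition irreducible_rep ::
  "('g, 'x) monoid_scheme \<Rightarrow> (complex \<Rightarrow> 'v::ab_group_add \<Rightarrow> 'v) \<Rightarrow> ('g \<Rightarrow> 'v \<Rightarrow> 'v) \<Rightarrow> bool" where
  "irreducible_rep G scale \<rho> \<longleftrightarrow>
     \<rho> \<in> hom G (GL scale) \<and> (UNIV :: 'v set) \<noteq> {0} \<and>
     (\<forall>W. module.subspace scale W \<longrightarrow> (\<forall>g\<in>carrier G. \<rho> g ` W \<subseteq> W) \<longrightarrow> W = {0} \<or> W = UNIV)"

definition quandle_rep ::
  "'q set \<Rightarrow> ('q \<Rightarrow> 'q \<Rightarrow> 'q) \<Rightarrow> (complex \<Rightarrow> 'v::ab_group_add \<Rightarrow> 'v) \<Rightarrow> ('q \<Rightarrow> 'v \<Rightarrow> 'v) \<Rightarrow> bool" where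
  "quandle_rep Q qop scale \<rho> \<longleftrightarrow>
     (\<forall>x\<in>Q. \<rho> x \<in> carrier (GL scale)) \<and>
     (\<forall>x\<in>Q. \<forall>y\<in>Q. \<rho> (qop x y) = \<rho> x \<otimes>\<^bsub>GL scale\<^esub> \<rho> y \<otimes>\<^bsub>GL scale\<^esub> inv\<^bsub>GL scale\<^esub> \<rho> x)"

definition twist ::
  "(complex \<Rightarrow> 'v \<Rightarrow> 'v) \<Rightarrow> ('q \<Rightarrow> complex) \<Rightarrow> ('q \<Rightarrow> 'v \<Rightarrow> 'v) \<Rightarrow> ('q \<Rightarrow> 'v \<Rightarrow> 'v)" where
  "twist scale \<chi> \<rho> x = (\<lambda>v. scale (\<chi> x) (\<rho> x v))"


section \<open>Well-definedness\<close>

lemma coboundary1_cocycle: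
  assumes "group G" "comm_group A" "f \<in> carrier (cochains1 G A)"
  shows "coboundary2 G A (coboundary1 G A f) = \<one>\<^bsub>cochains3 G A\<^esub>"
proof -
  interpret G: group G by fact
  interpret A: comm_group A by fact
  have f: "f x \<in> carrier A" if "x \<in> carrier G" for x
    using assms(3) that by (auto simp: cochains1_def)
  have key: "(c \<otimes>\<^bsub>A\<^esub> inv\<^bsub>A\<^esub> yz \<otimes>\<^bsub>A\<^esub> b) \<otimes>\<^bsub>A\<^esub> inv\<^bsub>A\<^esub> (c \<otimes>\<^bsub>A\<^esub> inv\<^bsub>A\<^esub> xyz \<otimes>\<^bsub>A\<^esub> xy)
      \<otimes>\<^bsub>A\<^esub> (yz \<otimes>\<^bsub>A\<^esub> inv\<^bsub>A\<^esub> xyz \<otimes>\<^bsub>A\<^esub> a) \<otimes>\<^bsub>A\<^esub> inv\<^bsub>A\<^esub> (b \<otimes>\<^bsub>A\<^esub> inv\<^bsub>A\<^esub> xy \<otimes>\<^bsub>A\<^esub> a) = \<one>\<^bsub>A\<^esub>"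
    if "a \<in> carrier A" "b \<in> carrier A" "c \<in> carrier A" "xy \<in> carrier A" "yz \<in> carrier A"
      "xyz \<in> carrier A" for a b c xy yz xyz
  proof -
    have "(c \<otimes>\<^bsub>A\<^esub> inv\<^bsub>A\<^esub> yz \<otimes>\<^bsub>A\<^esub> b) \<otimes>\<^bsub>A\<^esub> inv\<^bsub>A\<^esub> (c \<otimes>\<^bsub>A\<^esub> inv\<^bsub>A\<^esub> xyz \<otimes>\<^bsub>A\<^esub> xy)
      \<otimes>\<^bsub>A\<^esub> (yz \<otimes>\<^bsub>A\<^esub> inv\<^bsub>A\<^esub> xyz \<otimes>\<^bsub>A\<^esub> a) \<otimes>\<^bsub>A\<^esub> inv\<^bsub>A\<^esub> (b \<otimes>\<^bsub>A\<^esub> inv\<^bsub>A\<^esub> xy \<otimes>\<^bsub>A\<^esub> a)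
      = (c \<otimes>\<^bsub>A\<^esub> inv\<^bsub>A\<^esub> c) \<otimes>\<^bsub>A\<^esub> ((inv\<^bsub>A\<^esub> yz \<otimes>\<^bsub>A\<^esub> yz) \<otimes>\<^bsub>A\<^esub> ((b \<otimes>\<^bsub>A\<^esub> inv\<^bsub>A\<^esub> b) \<otimes>\<^bsub>A\<^esub>
        ((xyz \<otimes>\<^bsub>A\<^esub> inv\<^bsub>A\<^esub> xyz) \<otimes>\<^bsub>A\<^esub> ((inv\<^bsub>A\<^esub> xy \<otimes>\<^bsub>A\<^esub> xy) \<otimes>\<^bsub>A\<^esub> (a \<otimes>\<^bsub>A\<^esub> inv\<^bsub>A\<^esub> a)))))"
      using that by (simp only: A.inv_mult A.inv_inv A.m_ac A.m_closed A.inv_closed)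
    then show ?thesis using that by simp
  qed
  show ?thesis
    by (rule ext) (auto simp: coboundary2_def coboundary1_def cochains3_def G.m_assoc
        intro!: key f)
qed

lemma coboundary1_hom:
  assumes "group G" "comm_group A"
  shows "coboundary1 G A \<in> hom (cochains1 G A) (cochains2 G A)"
proof -
  interpret G: group G by fact
  interpret A: comm_group A by fact
  show ?thesis
    by (auto simp: hom_def coboundary1_def cochains1_def cochains2_def fun_eq_iff PiE_iff
        A.inv_mult A.m_ac)
qed

lemma coboundary2_hom:
  assumes "group G" "comm_group A"
  shows "coboundary2 G A \<in> hom (cochains2 G A) (cochains3 G A)"
proof -
  interpret G: group G by fact
  interpret A: comm_group A by fact
  show ?thesis
    by (auto simp: hom_def coboundary2_def cochains3_def cochains2_def fun_eq_iff PiE_iff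
        A.inv_mult A.m_ac)
qed

lemma group_H2:
  assumes "group G" "comm_group A"
  shows "group (H2 G A)"
proof -
  interpret A: comm_group A by fact
  have C: "group (cochains1 G A)" "group (cochains2 G A)" "group (cochains3 G A)"
    by (simp_all add: cochains1_def cochains2_def cochains3_def)
  interpret d1: group_hom "cochains1 G A" "cochains2 G A" "coboundary1 G A"
    using C coboundary1_hom[OF assms] by (simp add: group_hom_def group_hom_axioms_def)
  interpret d2: group_hom "cochains2 G A" "cochains3 G A" "coboundary2 G A"
    using C coboundary2_hom[OF assms] by (simp add: group_hom_def group_hom_axioms_def)
  have com: "comm_group (cochains2 G A)"
    by (rule d1.H.group_comm_groupI) (auto simp: cochains2_def fun_eq_iff PiE_iff A.m_comm)
  have "group (cocycles2 G A)"
    unfolding cocycles2_def by (rule subgroup.subgroup_is_group[OF d2.subgroup_kernel C(2)])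
  then have Z: "comm_group (cocycles2 G A)"
    by (rule group.group_comm_groupI)
      (use comm_groupE(4)[OF com] in \<open>auto simp: cocycles2_def kernel_def\<close>)
  have sub: "coboundaries2 G A \<subseteq> kernel (cochains2 G A) (cochains3 G A) (coboundary2 G A)"
    using coboundary1_cocycle[OF assms] d1.hom_closed
    by (auto simp: coboundaries2_def kernel_def)
  have "subgroup (coboundaries2 G A) (cocycles2 G A)"
    unfolding cocycles2_def
    using d1.H.subgroup_incl[OF _ d2.subgroup_kernel sub] d1.img_is_subgroup
    by (simp add: coboundaries2_def)
  then have "coboundaries2 G A \<lhd> cocycles2 G A"
    by (rule comm_group.subgroup_imp_normal[OF Z])
  then show ?thesis unfolding H2_def by (rule normal.factorgroup_is_group)
qed

lemma comm_group_complex_units: "comm_group complex_units"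
  by (rule comm_groupI) (auto simp: complex_units_def intro!: bexI[of _ "inverse _"])

lemma group_Inn: "group (Inn Q qop)"
  unfolding Inn_def by (simp add: group_BijGroup group.group_subgroup_generated)

lemma group_GL:
  assumes "vector_space scale"
  shows "group (GL scale)"
proof -
  interpret vector_space scale by fact
  interpret P: vector_space_pair scale scale ..
  show ?thesis
  proof (rule groupI)
    fix f assume f: "f \<in> carrier (GL scale)"
    then have "Vector_Spaces.linear scale scale (inv_into UNIV f)"
      using P.bij_module_hom_imp_inv_module_hom
      by (metis (no_types, lifting) GL_def module_hom_iff_linear partial_object.select_convs(1) mem_Collect_eq)
    with f show "\<exists>g\<in>carrier (GL scale). g \<otimes>\<^bsub>GL scale\<^esub> f = \<one>\<^bsub>GL scale\<^esub>"
      by (auto simp: GL_def bij_imp_bij_inv bij_is_inj intro!: exI[of _ "inv_into UNIV f"])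
  qed (auto simp: GL_def linear_id bij_comp o_assoc intro: Vector_Spaces.linear_compose)
qed

context quandle
begin

lemma left_mult_Bij:
  assumes "x \<in> Q"
  shows "left_mult Q (\<rhd>) x \<in> carrier (BijGroup Q)"
proof -
  have "bij_betw (left_mult Q (\<rhd>) x) Q Q"
    unfolding bij_betw_def inj_on_def
  proof (intro conjI ballI impI equalityI subsetI)
    fix y z assume "y \<in> Q" "z \<in> Q" "left_mult Q (\<rhd>) x y = left_mult Q (\<rhd>) x z"
    then show "y = z"
      using left_divisible[OF assms closed[OF assms, of z]] by (auto simp: left_mult_def)
  next
    fix y assume "y \<in> Q"
    then obtain z where "z \<in> Q" "x \<rhd> z = y" using left_divisible[OF assms] by blast
    then show "y \<in> left_mult Q (\<rhd>) x ` Q" by (auto simp: left_mult_def image_iff)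
  qed (use assms closed in \<open>auto simp: left_mult_def\<close>)
  then show ?thesis by (simp add: BijGroup_def Bij_def left_mult_def)
qed

lemma left_mult_Inn: "x \<in> Q \<Longrightarrow> left_mult Q (\<rhd>) x \<in> carrier (Inn Q (\<rhd>))"
  using left_mult_Bij by (auto simp: Inn_def carrier_subgroup_generated intro: generate.incl)

lemma left_mult_conj:
  assumes "x \<in> Q" "y \<in> Q"
  shows "left_mult Q (\<rhd>) (x \<rhd> y) \<otimes>\<^bsub>Inn Q (\<rhd>)\<^esub> left_mult Q (\<rhd>) x
       = left_mult Q (\<rhd>) x \<otimes>\<^bsub>Inn Q (\<rhd>)\<^esub> left_mult Q (\<rhd>) y"
proof -
  have "left_mult Q (\<rhd>) z \<in> Bij Q" if "z \<in> Q" for z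
    using left_mult_Bij[OF that] by (simp add: BijGroup_def)
  then show ?thesis
    using assms closed
    by (auto simp: Inn_def BijGroup_def compose_def left_mult_def fun_eq_iff simp flip: self_distrib)
qed

end

lemma quandle_rep_twist:
  fixes scale :: "complex \<Rightarrow> 'v::ab_group_add \<Rightarrow> 'v"
  assumes "quandle Q qop" "vector_space scale"
    and \<rho>: "\<rho> \<in> hom (Inn Q qop) (GL scale)" and \<chi>: "quandle_character Q qop \<chi>"
  shows "quandle_rep Q qop scale (twist scale \<chi> (\<rho> \<circ> left_mult Q qop))"
proof -
  interpret quandle Q qop by fact
  interpret V: vector_space scale by fact
  interpret P: vector_space_pair scale scale ..
  interpret GL: group "GL scale" by (rule group_GL) fact
  let ?L = "left_mult Q qop" and ?t = "twist scale \<chi> (\<rho> \<circ> left_mult Q qop)"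
  have r: "\<rho> (?L x) \<in> carrier (GL scale)" if "x \<in> Q" for x
    using left_mult_Inn[OF that] \<rho> by (auto simp: hom_def)
  have t: "?t x \<in> carrier (GL scale)" if "x \<in> Q" for x
  proof -
    have lin: "Vector_Spaces.linear scale scale (\<rho> (?L x))" and b: "bij (\<rho> (?L x))"
      using r[OF that] by (auto simp: GL_def)
    have c: "\<chi> x \<noteq> 0" using \<chi> that by (simp add: quandle_character_def)
    have "bij (scale (\<chi> x))"
      by (rule o_bij[of "scale (inverse (\<chi> x))"]) (use c in \<open>auto simp: fun_eq_iff\<close>)
    then have "bij (scale (\<chi> x) \<circ> \<rho> (?L x))" using b by (rule bij_comp[rotated])
    moreover have "Vector_Spaces.linear scale scale (\<lambda>v. scale (\<chi> x) (\<rho> (?L x) v))"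
      using lin by (rule P.linear_compose_scale_right)
    ultimately show ?thesis by (simp add: GL_def twist_def comp_def)
  qed
  have "?t (qop x y) = ?t x \<otimes>\<^bsub>GL scale\<^esub> ?t y \<otimes>\<^bsub>GL scale\<^esub> inv\<^bsub>GL scale\<^esub> ?t x"
    if "x \<in> Q" "y \<in> Q" for x y
  proof -
    have "\<rho> (?L (qop x y)) \<otimes>\<^bsub>GL scale\<^esub> \<rho> (?L x) = \<rho> (?L x) \<otimes>\<^bsub>GL scale\<^esub> \<rho> (?L y)"
      using left_mult_conj[OF that] left_mult_Inn[OF that(1)] left_mult_Inn[OF that(2)]
        left_mult_Inn[OF closed[OF that]]
      by (simp flip: hom_mult[OF \<rho>])
    then have e: "\<rho> (?L (qop x y)) (\<rho> (?L x) v) = \<rho> (?L x) (\<rho> (?L y) v)" for v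
      by (simp add: GL_def fun_eq_iff)
    have s: "\<rho> (?L z) (scale c v) = scale c (\<rho> (?L z) v)" if "z \<in> Q" for z c v
      using r[OF that] P.linear_scale by (simp add: GL_def)
    have "?t (qop x y) \<otimes>\<^bsub>GL scale\<^esub> ?t x = ?t x \<otimes>\<^bsub>GL scale\<^esub> ?t y"
      using \<chi> that closed
      by (auto simp: GL_def twist_def fun_eq_iff s e quandle_character_def mult.commute)
    then show ?thesis using t that closed
      by (subst GL.inv_solve_right) simp_all
  qed
  with t show ?thesis by (simp add: quandle_rep_def)
qed

end

theory Submission
  imports Defs "HOL-Algebra.Multiplicative_Group"
begin

text \<open>A twisted operator \<open>\<chi> x \<cdot> \<rho>' L\<^sub>x\<close> is unitary exactly when \<open>\<rho>' L\<^sub>x\<close> scales the Hermitian form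
  by the factor \<open>1 / \<bar>\<chi> x\<bar>\<^sup>2\<close>. Since \<open>Q\<close> is finite, \<open>L\<^sub>x\<close> has finite order, hence so
  has \<open>\<rho>' L\<^sub>x\<close>; on a nonzero vector, which irreducibility provides, this makes a positive power
  of \<open>\<bar>\<chi> x\<bar>\<close> equal to \<open>1\<close> (\<open>isometric_multiple_finite_order\<close>). So \<open>\<bar>\<chi> x\<bar> = 1\<close> and \<open>\<rho>' L\<^sub>x\<close> is itself unitary, and because
  the \<open>L\<^sub>x\<close> generate \<open>Inn Q\<close> and the unitary group is closed under products and inverses, \<open>\<rho>'\<close> is
  unitary on all of \<open>Inn Q\<close> (\<open>unitary_on_generators\<close>). The converse is immediate.\<close>

lemma finite_Inn:
  assumes "finite Q"
  shows "finite (carrier (Inn Q qop))"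
proof (rule finite_subset)
  show "carrier (Inn Q qop) \<subseteq> Q \<rightarrow>\<^sub>E Q"
    using group.carrier_subgroup_generated_subset[OF group_BijGroup, of Q]
    by (force simp: Inn_def BijGroup_def Bij_def PiE_iff dest: bij_betwE)
  show "finite (Q \<rightarrow>\<^sub>E Q)"
    using assms by (simp add: finite_PiE)
qed

lemma subgroup_unitary_group:
  assumes "vector_space scale"
  shows "subgroup (unitary_group scale herm) (GL scale)"
proof -
  interpret GL: group "GL scale" by (rule group_GL) fact
  have inv: "inv\<^bsub>GL scale\<^esub> f \<in> unitary_group scale herm" if f: "f \<in> unitary_group scale herm" for f
  proof -
    have c: "f \<in> carrier (GL scale)" using f by (simp add: unitary_group_def)
    have r: "f ((inv\<^bsub>GL scale\<^esub> f) v) = v" for v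
      using GL.r_inv[OF c] by (simp add: GL_def fun_eq_iff)
    show ?thesis
      unfolding unitary_group_def
    proof (intro CollectI conjI allI)
      show "inv\<^bsub>GL scale\<^esub> f \<in> carrier (GL scale)" using c by (rule GL.inv_closed)
      fix v w
      have "herm (f ((inv\<^bsub>GL scale\<^esub> f) v)) (f ((inv\<^bsub>GL scale\<^esub> f) w))
          = herm ((inv\<^bsub>GL scale\<^esub> f) v) ((inv\<^bsub>GL scale\<^esub> f) w)"
        using f by (simp add: unitary_group_def)
      then show "herm ((inv\<^bsub>GL scale\<^esub> f) v) ((inv\<^bsub>GL scale\<^esub> f) w) = herm v w"
        by (simp only: r)
    qed
  qed
  show ?thesis
  proof (rule GL.subgroupI)
    have "\<one>\<^bsub>GL scale\<^esub> \<in> unitary_group scale herm"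
      unfolding unitary_group_def using GL.one_closed by (simp add: GL_def)
    then show "unitary_group scale herm \<noteq> {}" by blast
    fix f g assume "f \<in> unitary_group scale herm" "g \<in> unitary_group scale herm"
    then show "f \<otimes>\<^bsub>GL scale\<^esub> g \<in> unitary_group scale herm"
      unfolding unitary_group_def using GL.m_closed[of f g] by (auto simp: GL_def)
  qed (use inv in \<open>auto simp: unitary_group_def\<close>)
qed

lemma unitary_on_generators:
  assumes "group G" and "vector_space scale"
    and hom: "\<rho> \<in> hom (subgroup_generated G S) (GL scale)"
    and gen: "\<And>s. s \<in> carrier G \<inter> S \<Longrightarrow> \<rho> s \<in> unitary_group scale herm"
    and g: "g \<in> carrier (subgroup_generated G S)"
  shows "\<rho> g \<in> unitary_group scale herm"
proof -
  interpret G: group G by fact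
  let ?H = "subgroup_generated G S"
  interpret U: subgroup "unitary_group scale herm" "GL scale"
    by (rule subgroup_unitary_group) fact
  interpret GL: group "GL scale" by (rule group_GL) fact
  interpret H: group ?H by (rule G.group_subgroup_generated)
  interpret h: group_hom ?H "GL scale" \<rho>
    by unfold_locales (rule hom)
  from g have "g \<in> generate G (carrier G \<inter> S)"
    by (simp add: carrier_subgroup_generated)
  then show ?thesis
  proof induction
    case one
    show ?case using h.hom_one U.one_closed by simp
  next
    case (incl s)
    then show ?case by (rule gen)
  next
    case (inv s)
    then have s: "s \<in> carrier ?H" by (simp add: carrier_subgroup_generated generate.incl)
    then have "\<rho> (inv\<^bsub>G\<^esub> s) = inv\<^bsub>GL scale\<^esub> (\<rho> s)"
      using h.hom_inv[OF s] by simp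
    then show ?case using gen[OF inv] U.m_inv_closed by simp
  next
    case (eng a b)
    then show ?case
      using h.hom_mult[of a b] U.m_closed by (simp add: carrier_subgroup_generated)
  qed
qed

lemma herm_scale_right:
  assumes "hermitian_space scale herm"
  shows "herm v (scale c w) = cnj c * herm v w"
proof -
  interpret hermitian_space scale herm by fact
  have "herm v (scale c w) = cnj (herm (scale c w) v)" by (rule herm_cnj)
  also have "\<dots> = cnj c * herm v w" by (simp add: herm_scale flip: herm_cnj[of v w])
  finally show ?thesis .
qed

text \<open>If a scalar multiple of an operator of finite order preserves the norm of a positive definite
  form, then the scalar has modulus one: each application of the operator divides the norm of a
  nonzero vector by the modulus of the scalar, while some positive power of the operator fixes the
  vector.\<close>

lemma isometric_multiple_finite_order:
  fixes scale :: "complex \<Rightarrow> 'v::ab_group_add \<Rightarrow> 'v"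
  assumes "hermitian_space scale herm" and "group G" and "finite (carrier G)"
    and hom: "\<rho> \<in> hom G (GL scale)" and g: "g \<in> carrier G"
    and iso: "\<And>v. herm (scale c (\<rho> g v)) (scale c (\<rho> g v)) = herm v v"
    and nonzero: "(UNIV :: 'v set) \<noteq> {0}"
  shows "cmod c = 1"
proof -
  interpret hermitian_space scale herm by fact
  interpret G: group G by fact
  interpret GL: group "GL scale" by (rule group_GL) unfold_locales
  interpret h: group_hom G "GL scale" \<rho>
    by unfold_locales (rule hom)
  have step: "complex_of_real ((cmod c)\<^sup>2) * herm (\<rho> g v) (\<rho> g v) = herm v v" for v
  proof -
    have "herm (scale c (\<rho> g v)) (scale c (\<rho> g v)) = c * (cnj c * herm (\<rho> g v) (\<rho> g v))"
      by (simp add: herm_scale herm_scale_right[OF assms(1)] mult.left_commute)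
    then show ?thesis
      using iso[of v] by (simp only: complex_norm_square mult.assoc)
  qed
  have pow: "complex_of_real (((cmod c)\<^sup>2) ^ n) * herm (\<rho> (g [^]\<^bsub>G\<^esub> n) v) (\<rho> (g [^]\<^bsub>G\<^esub> n) v) = herm v v"
    for n :: nat and v
  proof (induction n arbitrary: v)
    case 0
    show ?case using h.hom_one by (simp add: GL_def)
  next
    case (Suc n)
    have "\<rho> (g [^]\<^bsub>G\<^esub> Suc n) v = \<rho> (g [^]\<^bsub>G\<^esub> n) (\<rho> g v)"
      using g by (simp add: GL_def)
    then show ?case
      using Suc[of "\<rho> g v"] step[of v] by (simp add: mult.assoc mult.left_commute)
  qed
  obtain v :: 'v where v: "v \<noteq> 0" using nonzero by blast
  let ?n = "order G"
  have "\<rho> (g [^]\<^bsub>G\<^esub> ?n) v = v"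
    using G.pow_order_eq_1[OF g] h.hom_one by (simp add: GL_def)
  then have "complex_of_real (((cmod c)\<^sup>2) ^ ?n) * herm v v = herm v v"
    using pow[of ?n v] by simp
  moreover have "herm v v \<noteq> 0"
    using herm_pos[OF v] by auto
  ultimately have "complex_of_real (((cmod c)\<^sup>2) ^ ?n) = 1"
    by (metis mult_right_cancel mult_1_left)
  then have "(cmod c) ^ (2 * ?n) = 1"
    by (simp only: of_real_eq_1_iff power_mult)
  moreover have "?n > 0"
    using G.order_gt_0_iff_finite assms(3) by simp
  ultimately show ?thesis
    using power_eq_1_iff[of "cmod c" "2 * ?n"] by simp
qed

text \<open>Over a scalar of modulus one, twisting does not affect whether the form is preserved.\<close>

lemma herm_scale_unit:
  assumes "hermitian_space scale herm" and "cmod c = 1"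
  shows "herm (scale c v) (scale c w) = herm v w"
proof -
  interpret hermitian_space scale herm by fact
  have "herm (scale c v) (scale c w) = c * (cnj c * herm v w)"
    by (simp add: herm_scale herm_scale_right[OF assms(1)] mult.left_commute)
  also have "\<dots> = herm v w"
    using assms(2) complex_norm_square[of c] by (simp flip: mult.assoc)
  finally show ?thesis .
qed

theorem mainTheorem11:
  fixes Q :: "'q set" and qop :: "'q \<Rightarrow> 'q \<Rightarrow> 'q"
    and scale :: "complex \<Rightarrow> 'v::ab_group_add \<Rightarrow> 'v" and herm :: "'v \<Rightarrow> 'v \<Rightarrow> complex"
    and \<rho>' :: "('q \<Rightarrow> 'q) \<Rightarrow> 'v \<Rightarrow> 'v" and \<chi> :: "'q \<Rightarrow> complex"
  assumes "quandle Q qop" and "finite Q"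
    and "trivial_group (H2 (Inn Q qop) complex_units)"
    and "hermitian_space scale herm"
    and "irreducible_rep (Inn Q qop) scale \<rho>'"
    and "quandle_character Q qop \<chi>"
  shows "(\<forall>x\<in>Q. twist scale \<chi> (\<rho>' \<circ> left_mult Q qop) x \<in> unitary_group scale herm) \<longleftrightarrow>
     (\<forall>g\<in>carrier (Inn Q qop). \<rho>' g \<in> unitary_group scale herm) \<and> (\<forall>x\<in>Q. cmod (\<chi> x) = 1)"
proof -
  interpret quandle Q qop by fact
  interpret hermitian_space scale herm by fact
  have vs: "vector_space scale" by unfold_locales
  have hom: "\<rho>' \<in> hom (Inn Q qop) (GL scale)" and nonzero: "(UNIV :: 'v set) \<noteq> {0}"
    using assms(5) by (auto simp: irreducible_rep_def)
  let ?t = "twist scale \<chi> (\<rho>' \<circ> left_mult Q qop)"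
  have t_GL: "?t x \<in> carrier (GL scale)" if "x \<in> Q" for x
    using quandle_rep_twist[OF assms(1) vs hom assms(6)] that by (simp add: quandle_rep_def)
  have L_GL: "\<rho>' (left_mult Q qop x) \<in> carrier (GL scale)" if "x \<in> Q" for x
    using hom left_mult_Inn[OF that] by (auto simp: hom_def)
  have iff: "?t x \<in> unitary_group scale herm \<longleftrightarrow> \<rho>' (left_mult Q qop x) \<in> unitary_group scale herm"
    if "x \<in> Q" "cmod (\<chi> x) = 1" for x
    using t_GL[OF that(1)] L_GL[OF that(1)] herm_scale_unit[OF assms(4) that(2)]
    by (simp add: unitary_group_def twist_def)
  show ?thesis
  proof (intro iffI conjI ballI)
    assume u: "\<forall>x\<in>Q. ?t x \<in> unitary_group scale herm"
    show mod1: "cmod (\<chi> x) = 1" if x: "x \<in> Q" for x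
    proof (rule isometric_multiple_finite_order[OF assms(4) group_Inn finite_Inn[OF assms(2)] hom
          left_mult_Inn[OF x] _ nonzero])
      fix v
      show "herm (scale (\<chi> x) (\<rho>' (left_mult Q qop x) v)) (scale (\<chi> x) (\<rho>' (left_mult Q qop x) v))
          = herm v v"
        using u x by (simp add: unitary_group_def twist_def)
    qed
    fix g assume g: "g \<in> carrier (Inn Q qop)"
    show "\<rho>' g \<in> unitary_group scale herm"
    proof (rule unitary_on_generators[OF group_BijGroup vs hom[unfolded Inn_def] _ g[unfolded Inn_def]])
      fix s assume "s \<in> carrier (BijGroup Q) \<inter> left_mult Q qop ` Q"
      then obtain x where "x \<in> Q" "s = left_mult Q qop x" by blast
      then show "\<rho>' s \<in> unitary_group scale herm"
        using u iff mod1 by blast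
    qed
  next
    fix x assume "(\<forall>g\<in>carrier (Inn Q qop). \<rho>' g \<in> unitary_group scale herm) \<and> (\<forall>x\<in>Q. cmod (\<chi> x) = 1)"
      and x: "x \<in> Q"
    then show "?t x \<in> unitary_group scale herm"
      using iff left_mult_Inn by blast
  qed
qed

end
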